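(* Let $X$ be a Lévy process in $\mathbb{R}^d$, $d\in\mathbb{N}$. For a Borel function $q:\mathbb{R}\times\mathbb{R}^d\to\mathbb{R}$ we have $$\lim_{t\to 0^+}\Big[\sup_{s\in\mathbb{R},\,x\in\mathbb{R}^d}\mathbb{E}^x\Big(\int_0^t|q(s+u,X_u)|\,du\Big)\Big]=0$$ if and only if $$\lim_{r\to 0^+}\Big[\sup_{s\in\mathbb{R},\,x\in\mathbb{R}^d}\mathbb{E}^x\Big(\int_0^r\mathbf 1_{B(x,r)}(X_u)\,|q(s+u,X_u)|\,du\Big)\Big]=0 .$$
   Context: $\mathbb{P}^x,\mathbb{E}^x$ denote the law and expectation of the Lévy process started at $x$, i.e. $\mathbb{E}^xF(X)=\mathbb{E}^0F(X+x)$. $B(x,r)$ is the open Euclidean ball in $\mathbb{R}^d$. *)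

theory Defs
  imports "HOL-Probability.Probability"
begin

definition cadlag :: "(real \<Rightarrow> 'a::topological_space) \<Rightarrow> bool" where
  "cadlag f \<longleftrightarrow> (\<forall>t\<ge>0. (f \<longlongrightarrow> f t) (at_right t)) \<and> (\<forall>t>0. \<exists>l. (f \<longlongrightarrow> l) (at_left t))"

text \<open>
  The process \<open>X\<close> is the one started at the origin. Only times \<open>t \<ge> 0\<close> matter: nothing is
  required of \<open>X t\<close> for negative \<open>t\<close>. Stochastic continuity, which some authors list
  separately, follows from right continuity of the paths and stationarity of the increments.
\<close>

locale levy_process = prob_space M
  for M :: "'w measure" and X :: "real \<Rightarrow> 'w \<Rightarrow> 'a::euclidean_space" +
  assumes random_variable: "\<And>t. 0 \<le> t \<Longrightarrow> random_variable borel (X t)"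
    and starts_at_0: "AE \<omega> in M. X 0 \<omega> = 0"
    and independent_increments:
      "\<And>(n::nat) (t :: nat \<Rightarrow> real). 0 \<le> t 0 \<Longrightarrow> (\<And>i. i < n \<Longrightarrow> t i < t (Suc i)) \<Longrightarrow>
         indep_vars (\<lambda>_. borel) (\<lambda>i \<omega>. X (t (Suc i)) \<omega> - X (t i) \<omega>) {..<n}"
    and stationary_increments:
      "\<And>s h. 0 \<le> s \<Longrightarrow> 0 \<le> h \<Longrightarrow>
         distr M borel (\<lambda>\<omega>. X (s + h) \<omega> - X s \<omega>) = distr M borel (X h)"
    and cadlag_paths: "AE \<omega> in M. cadlag (\<lambda>t. X t \<omega>)"

text \<open>
  The expectation \<open>E\<^sup>x F(X) = E\<^sup>0 F(X + x)\<close> of a functional of the path with values in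
  \<open>[0, \<infinity>]\<close>. As the paths are cadlag only almost surely, \<open>F(X + x)\<close> may be measurable only
  up to a null set; this does not affect the value of the integral.
\<close>

definition expectation_from ::
    "'w measure \<Rightarrow> (real \<Rightarrow> 'w \<Rightarrow> 'a::real_vector) \<Rightarrow> 'a \<Rightarrow> ((real \<Rightarrow> 'a) \<Rightarrow> ennreal) \<Rightarrow> ennreal" where
  "expectation_from M X x F = (\<integral>\<^sup>+\<omega>. F (\<lambda>u. X u \<omega> + x) \<partial>M)"

end

theory Submission
  imports Defs
begin

text \<open>
  The local quantity is dominated by the global one. Conversely, let \<open>G(t)\<close> be the global supremum,
  \<open>L(r)\<close> the local one, and \<open>\<tau>\<close> the first exit time from a ball of radius \<open>r / 2\<close> around the starting
  point. For \<open>t \<le> r\<close>, the part of the integral before \<open>\<tau>\<close> is at most \<open>L(r)\<close>, and by the Markov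
  property at \<open>\<tau>\<close> the remainder is at most \<open>P(\<tau> \<le> t) G(t)\<close>. Right continuity at \<open>0\<close> makes
  \<open>P(\<tau> \<le> t) \<le> 1/2\<close> for small \<open>t\<close>, so \<open>G(t) \<le> 2 L(r)\<close> as soon as \<open>G(t)\<close> is finite, which is
  arranged by truncating \<open>q\<close>.

  The strong Markov property is avoided by observing the process on the grid \<open>\<delta> \<nat>\<close> only. Then
  \<open>X\<^sub>u\<close> may leave the ball of radius \<open>r\<close> before the exit is noticed at a grid point, but
  this requires an increment of size \<open>r / 2\<close> within time \<open>\<delta>\<close>; the resulting error vanishes
  as \<open>\<delta> \<rightarrow> 0\<close> for bounded \<open>q\<close>.
\<close>

section \<open>Passing to a jointly measurable version of the process\<close>

text \<open>Independence says that the joint law is the product of the marginal laws, and an almost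
  sure change of finitely many variables alters none of these laws.\<close>

lemma (in prob_space) indep_vars_cong_AE:
  assumes "finite I" and ind: "indep_vars N X I"
    and Y: "\<And>i. i \<in> I \<Longrightarrow> random_variable (N i) (Y i)"
    and AE: "\<And>i. i \<in> I \<Longrightarrow> AE \<omega> in M. X i \<omega> = Y i \<omega>"
  shows "indep_vars N Y I"
proof (cases "I = {}")
  case True
  then show ?thesis
    by (simp add: indep_vars_def2 indep_sets_def)
next
  case False
  have X: "random_variable (N i) (X i)" if "i \<in> I" for i
    using ind that by (auto simp: indep_vars_def)
  have "AE \<omega> in M. \<forall>i\<in>I. X i \<omega> = Y i \<omega>"
    using \<open>finite I\<close> AE by (simp add: AE_finite_all)
  then have "distr M (PiM I N) (\<lambda>\<omega>. \<lambda>i\<in>I. X i \<omega>) = distr M (PiM I N) (\<lambda>\<omega>. \<lambda>i\<in>I. Y i \<omega>)"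
    by (intro distr_cong_AE measurable_restrict X Y)
       (auto elim!: eventually_mono simp: fun_eq_iff restrict_def)
  moreover have "(\<Pi>\<^sub>M i\<in>I. distr M (N i) (X i)) = (\<Pi>\<^sub>M i\<in>I. distr M (N i) (Y i))"
    using AE X Y by (intro PiM_cong distr_cong_AE) auto
  ultimately show ?thesis
    using ind X Y False by (simp add: indep_vars_iff_distr_eq_PiM')
qed

text \<open>Taking \<open>\<lfloor>_\<rfloor> + 1\<close> instead of the ceiling keeps the grid
  point strictly to the right of \<open>u\<close>, even when \<open>u\<close> lies on the grid.
  Limits along \<open>at_right u\<close>, hence right continuity, can then be applied to the grid
  points.\<close>

lemma at_right_ceiling_approx:
  fixes u :: real
  shows "filterlim (\<lambda>n. of_int (\<lfloor>u * real (Suc n)\<rfloor> + 1) / real (Suc n)) (at_right u) sequentially"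
proof -
  let ?g = "\<lambda>n. of_int (\<lfloor>u * real (Suc n)\<rfloor> + 1) / real (Suc n)"
  have gt: "u < ?g n" for n
    by (subst pos_less_divide_eq) (simp, linarith)
  have le: "?g n \<le> u + 1 / real (Suc n)" for n
    using of_int_floor_le[of "u * real (Suc n)"] by (simp add: field_simps del: of_nat_Suc of_int_floor_le)
  have "(\<lambda>n. u + 1 / real (Suc n)) \<longlonglongrightarrow> u + 0"
    by (intro tendsto_intros LIMSEQ_Suc lim_1_over_n)
  then have "?g \<longlonglongrightarrow> u"
    by (intro tendsto_sandwich[of "\<lambda>_. u" ?g sequentially])
       (use gt le in \<open>auto intro!: always_eventually less_imp_le simp del: of_nat_Suc of_int_add\<close>)
  then show ?thesis
    unfolding filterlim_at using gt
    by (auto simp: less_imp_neq[symmetric] intro!: always_eventually simp del: of_nat_Suc of_int_add)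
qed

text \<open>Replacing the time by the next grid point gives a process that uses only countably many
  of the \<open>Y u\<close>, hence a jointly measurable one; by right continuity these
  discretizations converge pointwise to \<open>Y\<close>.\<close>

lemma borel_measurable_right_continuous_process:
  fixes Y :: "real \<Rightarrow> 'w \<Rightarrow> 'a::{metric_space}"
  assumes Y: "\<And>u. Y u \<in> borel_measurable M"
    and right: "\<And>u \<omega>. \<omega> \<in> space M \<Longrightarrow> ((\<lambda>v. Y v \<omega>) \<longlongrightarrow> Y u \<omega>) (at_right u)"
  shows "(\<lambda>(\<omega>, u). Y u \<omega>) \<in> borel_measurable (M \<Otimes>\<^sub>M borel)"
proof (rule borel_measurable_LIMSEQ_metric)
  let ?g = "\<lambda>n u. of_int (\<lfloor>u * real (Suc n)\<rfloor> + 1) / real (Suc n) :: real"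
  show "(\<lambda>p. Y (?g n (snd p)) (fst p)) \<in> borel_measurable (M \<Otimes>\<^sub>M borel)" for n
  \<comment> \<open>The discretized process depends on the time only through one integer, so it is
    glued from countably many measurable pieces.\<close>
  proof (rule measurable_compose_countable
      [where f = "\<lambda>i p. Y (of_int (i + 1) / real (Suc n)) (fst p)"])
    show "(\<lambda>p. Y (of_int (i + 1) / real (Suc n)) (fst p)) \<in> borel_measurable (M \<Otimes>\<^sub>M borel)" for i
      using Y by measurable
    show "(\<lambda>p. \<lfloor>snd p * real (Suc n)\<rfloor>) \<in> measurable (M \<Otimes>\<^sub>M borel) (count_space UNIV)"
      by measurable
  qed
  show "(\<lambda>n. Y (?g n (snd p)) (fst p)) \<longlonglongrightarrow> (case p of (\<omega>, u) \<Rightarrow> Y u \<omega>)"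
    if "p \<in> space (M \<Otimes>\<^sub>M borel)" for p
    using that
    by (auto simp: space_pair_measure simp del: of_nat_Suc of_int_add
        intro!: filterlim_compose[OF right at_right_ceiling_approx])
qed

text \<open>Joint measurability allows the exchange of expectation and time integral. The start at 0
  holds for every path, so that sums of increments give back the positions exactly.\<close>

locale measurable_levy_process = levy_process M X
  for M :: "'w measure" and X :: "real \<Rightarrow> 'w \<Rightarrow> 'a::euclidean_space" +
  assumes jointly_measurable: "(\<lambda>(\<omega>, u). X u \<omega>) \<in> borel_measurable (M \<Otimes>\<^sub>M borel)"
    and X_0: "\<And>\<omega>. X 0 \<omega> = 0"

text \<open>The paths are altered on one null set only, so a single exceptional set serves all times
  \<open>t \<ge> 0\<close>; integrals along the path therefore do not change almost surely.\<close>

lemma (in levy_process) measurable_version: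
  obtains Y where "measurable_levy_process M Y"
    and "AE \<omega> in M. \<forall>t\<ge>0. Y t \<omega> = X t \<omega>"
proof -
  have "AE \<omega> in M. X 0 \<omega> = 0 \<and> cadlag (\<lambda>t. X t \<omega>)"
    using starts_at_0 cadlag_paths by eventually_elim auto
  then obtain N where N: "N \<in> null_sets M"
    and good: "\<And>\<omega>. \<omega> \<in> space M - N \<Longrightarrow> X 0 \<omega> = 0 \<and> cadlag (\<lambda>t. X t \<omega>)"
    by (elim AE_E3) blast
  have [measurable]: "N \<in> sets M"
    using N by auto
  \<comment> \<open>The value 0 on the bad set and at negative times makes every path right
    continuous on the whole line and makes it start at 0.\<close>
  define Y where "Y t \<omega> = (if \<omega> \<in> space M - N \<and> 0 \<le> t then X t \<omega> else 0)" for t \<omega>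
  have Y: "Y t \<in> borel_measurable M" for t
  proof (cases "0 \<le> t")
    case True
    note [measurable] = random_variable[OF True]
    show ?thesis
      using True unfolding Y_def by measurable
  next
    case False
    then show ?thesis
      by (simp add: Y_def[abs_def])
  qed
  have eq: "AE \<omega> in M. \<forall>t\<ge>0. Y t \<omega> = X t \<omega>"
    using AE_not_in[OF N] AE_space by eventually_elim (auto simp: Y_def)
  have eq_t: "AE \<omega> in M. Y t \<omega> = X t \<omega>" if "0 \<le> t" for t
    using eq by eventually_elim (use that in auto)
  have right: "((\<lambda>v. Y v \<omega>) \<longlongrightarrow> Y u \<omega>) (at_right u)" if "\<omega> \<in> space M" for u \<omega>
  proof (cases "\<omega> \<in> N \<or> u < 0")
    case True
    have "\<forall>\<^sub>F v in at_right u. Y v \<omega> = Y u \<omega>"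
    proof (cases "\<omega> \<in> N")
      case False
      with True have "u < 0" by auto
      then show ?thesis
        by (intro eventually_at_rightI[of u 0]) (auto simp: Y_def)
    qed (simp add: Y_def)
    then show ?thesis
      by (rule tendsto_eventually)
  next
    case False
    then have "((\<lambda>v. X v \<omega>) \<longlongrightarrow> X u \<omega>) (at_right u)"
      using good[of \<omega>] that by (auto simp: cadlag_def)
    moreover have "\<forall>\<^sub>F v in at_right u. X v \<omega> = Y v \<omega>"
      using False that by (intro eventually_at_rightI[of u "u + 1"]) (auto simp: Y_def)
    moreover have "Y u \<omega> = X u \<omega>"
      using False that by (auto simp: Y_def)
    ultimately show ?thesis
      by (simp add: tendsto_cong)
  qed
  have "measurable_levy_process M Y"
  proof
    show "random_variable borel (Y t)" if "0 \<le> t" for t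
      by (rule Y)
    show "Y 0 \<omega> = 0" for \<omega>
      using good by (auto simp: Y_def)
    then show "AE \<omega> in M. Y 0 \<omega> = 0"
      by simp
    show "indep_vars (\<lambda>_. borel) (\<lambda>i \<omega>. Y (t (Suc i)) \<omega> - Y (t i) \<omega>) {..<n}"
      if t: "0 \<le> t 0" "\<And>i. i < n \<Longrightarrow> t i < t (Suc i)" for n and t :: "nat \<Rightarrow> real"
    proof (rule indep_vars_cong_AE[OF _ independent_increments[OF t]])
      fix i assume "i \<in> {..<n}"
      \<comment> \<open>\<open>Y\<close> agrees with \<open>X\<close> at nonnegative times only; the
        times \<open>t i\<close> increase from \<open>t 0 \<ge> 0\<close>.\<close>
      moreover have pos: "0 \<le> t i" if "i \<le> n" for i
        using that
      proof (induction i)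
        case (Suc i)
        with t(2)[of i] show ?case by simp
      qed (use t in simp)
      ultimately have "0 \<le> t i" "0 \<le> t (Suc i)"
        by simp_all
      then show "AE \<omega> in M. X (t (Suc i)) \<omega> - X (t i) \<omega> = Y (t (Suc i)) \<omega> - Y (t i) \<omega>"
        using eq by (auto elim!: eventually_mono)
    qed (use Y in auto)
    show "distr M borel (\<lambda>\<omega>. Y (s + h) \<omega> - Y s \<omega>) = distr M borel (Y h)"
      if "0 \<le> s" "0 \<le> h" for s h
    proof -
      have "distr M borel (\<lambda>\<omega>. Y (s + h) \<omega> - Y s \<omega>) = distr M borel (\<lambda>\<omega>. X (s + h) \<omega> - X s \<omega>)"
        using that eq Y random_variable
        by (intro distr_cong_AE borel_measurable_diff) (auto elim!: eventually_mono)
      also have "\<dots> = distr M borel (X h)"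
        using that by (rule stationary_increments)
      also have "\<dots> = distr M borel (Y h)"
        using that eq_t[of h] Y random_variable by (intro distr_cong_AE) (auto elim!: eventually_mono)
      finally show ?thesis .
    qed
    show "AE \<omega> in M. cadlag (\<lambda>t. Y t \<omega>)"
      using AE_not_in[OF N] AE_space
    proof eventually_elim
      case (elim \<omega>)
      have "\<exists>l. ((\<lambda>v. Y v \<omega>) \<longlongrightarrow> l) (at_left t)" if "0 < t" for t
      proof -
        obtain l where "((\<lambda>v. X v \<omega>) \<longlongrightarrow> l) (at_left t)"
          using good[of \<omega>] elim \<open>0 < t\<close> by (auto simp: cadlag_def)
        moreover have "\<forall>\<^sub>F v in at_left t. X v \<omega> = Y v \<omega>"
          using elim \<open>0 < t\<close> by (intro eventually_at_leftI[of 0]) (auto simp: Y_def)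
        ultimately show ?thesis
          by (auto simp: tendsto_cong)
      qed
      with right elim show ?case
        by (simp add: cadlag_def)
    qed
    show "(\<lambda>(\<omega>, u). Y u \<omega>) \<in> borel_measurable (M \<Otimes>\<^sub>M borel)"
      using Y right by (rule borel_measurable_right_continuous_process)
  qed
  with eq show ?thesis
    by (rule that[rotated])
qed

section \<open>Markov property at a fixed time, and small oscillation near time 0\<close>

text \<open>The increment after time \<open>t k\<close> is independent of the earlier ones and has
  the law of \<open>X (u - t k)\<close>. Its joint law with them is thus a product, and the iterated
  integral replaces it by an independent copy.\<close>

lemma (in levy_process) nn_integral_markov:
  fixes t :: "nat \<Rightarrow> real"
  assumes X_0: "\<And>\<omega>. X 0 \<omega> = 0"
    and t: "0 \<le> t 0" "\<And>i. i < k \<Longrightarrow> t i < t (Suc i)" and u: "t k \<le> u"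
    and g: "case_prod g \<in> borel_measurable ((\<Pi>\<^sub>M i\<in>{..<k}. borel) \<Otimes>\<^sub>M borel)"
  shows "(\<integral>\<^sup>+\<omega>. g (\<lambda>i\<in>{..<k}. X (t (Suc i)) \<omega> - X (t i) \<omega>) (X u \<omega> - X (t k) \<omega>) \<partial>M) =
    (\<integral>\<^sup>+\<omega>. \<integral>\<^sup>+\<omega>'. g (\<lambda>i\<in>{..<k}. X (t (Suc i)) \<omega> - X (t i) \<omega>) (X (u - t k) \<omega>') \<partial>M \<partial>M)"
\<comment> \<open>Independence of increments is available for strictly increasing times; if
  \<open>t k = u\<close>, the last increment is 0 on both sides because of
  \<open>X_0\<close>.\<close>
proof (cases "t k = u")
  case True
  then show ?thesis
    by (simp add: X_0 emeasure_space_1)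
next
  case False
  with u have less: "t k < u" by simp
  have pos: "0 \<le> t i" if "i \<le> k" for i
    using that
  proof (induction i)
    case (Suc i)
    with t(2)[of i] show ?case by simp
  qed (use t in simp)
  note [measurable] = random_variable
  \<comment> \<open>Grouping an independent family by index sets produces families even for a single
    index, so the last increment is carried as a function on \<open>{k}\<close> until its coordinate
    is extracted.\<close>
  let ?P = "\<Pi>\<^sub>M i\<in>{..<k}. borel" and ?Q = "\<Pi>\<^sub>M i\<in>{k}. borel"
    and ?V = "\<lambda>\<omega>. \<lambda>i\<in>{..<k}. X (t (Suc i)) \<omega> - X (t i) \<omega>"
    and ?W = "\<lambda>\<omega>. X u \<omega> - X (t k) \<omega>"
  \<comment> \<open>Appending \<open>u\<close> to the times makes the increment from
    \<open>t k\<close> to \<open>u\<close> the last member of one independent family.\<close>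
  let ?t = "\<lambda>i. if i \<le> k then t i else u"
  have "indep_vars (\<lambda>_. borel) (\<lambda>i \<omega>. X (?t (Suc i)) \<omega> - X (?t i) \<omega>) {..<Suc k}"
    by (rule independent_increments) (use t less in \<open>auto simp: less_Suc_eq\<close>)
  then have "indep_var ?P (\<lambda>\<omega>. \<lambda>i\<in>{..<k}. X (?t (Suc i)) \<omega> - X (?t i) \<omega>)
    ?Q (\<lambda>\<omega>. \<lambda>i\<in>{k}. X (?t (Suc i)) \<omega> - X (?t i) \<omega>)"
    by (rule indep_var_restrict) auto
  moreover have "(\<lambda>\<omega>. \<lambda>i\<in>{..<k}. X (?t (Suc i)) \<omega> - X (?t i) \<omega>) = ?V"
    by (auto simp: fun_eq_iff restrict_def)
  moreover have "(\<lambda>\<omega>. \<lambda>i\<in>{k}. X (?t (Suc i)) \<omega> - X (?t i) \<omega>) = (\<lambda>\<omega>. \<lambda>i\<in>{k}. ?W \<omega>)"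
    by (auto simp: fun_eq_iff restrict_def)
  ultimately have "indep_var ?P ?V ?Q (\<lambda>\<omega>. \<lambda>i\<in>{k}. ?W \<omega>)"
    by simp
  then have V: "?V \<in> measurable M ?P" and W': "(\<lambda>\<omega>. \<lambda>i\<in>{k}. ?W \<omega>) \<in> measurable M ?Q"
    and joint: "distr M ?P ?V \<Otimes>\<^sub>M distr M ?Q (\<lambda>\<omega>. \<lambda>i\<in>{k}. ?W \<omega>) =
      distr M (?P \<Otimes>\<^sub>M ?Q) (\<lambda>\<omega>. (?V \<omega>, \<lambda>i\<in>{k}. ?W \<omega>))"
    by (auto simp: indep_var_distribution_eq)
  have W: "?W \<in> borel_measurable M"
    using random_variable[of u] random_variable[of "t k"] pos[of k] less
    by (intro borel_measurable_diff) auto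
  interpret W: prob_space "distr M ?Q (\<lambda>\<omega>. \<lambda>i\<in>{k}. ?W \<omega>)"
    using W' by (rule prob_space_distr)
  have g': "(\<lambda>(v, w). g v (w k)) \<in> borel_measurable (?P \<Otimes>\<^sub>M ?Q)"
    using measurable_compose[OF _ g, of "\<lambda>(v, w). (v, w k)" "?P \<Otimes>\<^sub>M ?Q"] by (simp add: case_prod_beta)
  have law: "distr M borel ?W = distr M borel (X (u - t k))"
    using stationary_increments[of "t k" "u - t k"] pos[of k] less by simp
  have "(\<integral>\<^sup>+\<omega>. g (?V \<omega>) (?W \<omega>) \<partial>M) =
      (\<integral>\<^sup>+(v, w). g v (w k) \<partial>distr M (?P \<Otimes>\<^sub>M ?Q) (\<lambda>\<omega>. (?V \<omega>, \<lambda>i\<in>{k}. ?W \<omega>)))"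
    using V W' g' by (subst nn_integral_distr) auto
  also have "\<dots> = (\<integral>\<^sup>+v. \<integral>\<^sup>+w. g v (w k) \<partial>distr M ?Q (\<lambda>\<omega>. \<lambda>i\<in>{k}. ?W \<omega>) \<partial>distr M ?P ?V)"
    unfolding joint[symmetric] using g'
    by (subst W.nn_integral_fst[symmetric]) (auto cong: measurable_cong_sets)
  also have "\<dots> = (\<integral>\<^sup>+\<omega>. \<integral>\<^sup>+w. g (?V \<omega>) (w k) \<partial>distr M ?Q (\<lambda>\<omega>. \<lambda>i\<in>{k}. ?W \<omega>) \<partial>M)"
    using V g' by (intro nn_integral_distr W.borel_measurable_nn_integral) (auto cong: measurable_cong_sets)
  also have "\<dots> = (\<integral>\<^sup>+\<omega>. \<integral>\<^sup>+\<omega>'. g (?V \<omega>) (X (u - t k) \<omega>') \<partial>M \<partial>M)"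
  proof (intro nn_integral_cong)
    fix \<omega> assume "\<omega> \<in> space M"
    then have "?V \<omega> \<in> space ?P"
      using V by (rule measurable_space[rotated])
    then have m: "g (?V \<omega>) \<in> borel_measurable borel" "(\<lambda>w. g (?V \<omega>) (w k)) \<in> borel_measurable ?Q"
      using g g' measurable_Pair2[OF g] measurable_Pair2[OF g'] by auto
    have "(\<integral>\<^sup>+w. g (?V \<omega>) (w k) \<partial>distr M ?Q (\<lambda>\<omega>. \<lambda>i\<in>{k}. ?W \<omega>)) = (\<integral>\<^sup>+\<omega>'. g (?V \<omega>) (?W \<omega>') \<partial>M)"
      using W' m by (subst nn_integral_distr) auto
    also have "\<dots> = (\<integral>\<^sup>+w. g (?V \<omega>) w \<partial>distr M borel ?W)"
      using W m by (subst nn_integral_distr) auto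
    also have "\<dots> = (\<integral>\<^sup>+\<omega>'. g (?V \<omega>) (X (u - t k) \<omega>') \<partial>M)"
      unfolding law using m less by (intro nn_integral_distr) auto
    finally show "(\<integral>\<^sup>+w. g (?V \<omega>) (w k) \<partial>distr M ?Q (\<lambda>\<omega>. \<lambda>i\<in>{k}. ?W \<omega>)) =
        (\<integral>\<^sup>+\<omega>'. g (?V \<omega>) (X (u - t k) \<omega>') \<partial>M)" .
  qed
  finally show ?thesis .
qed

text \<open>The events that the path gets far from the origin before time \<open>1 / Suc n\<close>
  decrease with \<open>n\<close>. By right continuity at 0 their intersection is null, so continuity
  from above makes one of them as unlikely as desired.\<close>

lemma (in levy_process) small_oscillation:
  assumes "0 < r" "0 < e"
  obtains S \<delta> where "0 < \<delta>" "S \<in> events" "prob S \<le> e"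
    "AE \<omega> in M. \<omega> \<notin> S \<longrightarrow> (\<forall>v\<in>{0..<\<delta>}. norm (X v \<omega>) < r)"
proof -
  \<comment> \<open>Rational times keep the union countable, hence measurable. The strict threshold
    \<open>r / 2\<close> lies below \<open>r\<close>, so an excursion to norm \<open>r\<close> at
    any time is seen at a nearby rational time.\<close>
  define S where "S n = (\<Union>v\<in>\<rat> \<inter> {0..<1 / real (Suc n)}. {\<omega> \<in> space M. r / 2 < norm (X v \<omega>)})" for n
  note [measurable] = random_variable
  have S: "S n \<in> events" for n
    unfolding S_def by (intro sets.countable_UN'' countable_Int1 countable_rat) auto
  have "decseq S"
    unfolding S_def
  proof (intro antimonoI UN_mono subset_refl)
    fix m n :: nat assume "m \<le> n"
    then have "1 / real (Suc n) \<le> 1 / real (Suc m)"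
      by (intro frac_le) auto
    then show "\<rat> \<inter> {0..<1 / real (Suc n)} \<subseteq> \<rat> \<inter> {0..<1 / real (Suc m)}"
      by auto
  qed
  then have "(\<lambda>n. prob (S n)) \<longlonglongrightarrow> prob (\<Inter>n. S n)"
    using S by (intro finite_Lim_measure_decseq) auto
  moreover have "prob (\<Inter>n. S n) = 0"
  proof (rule prob_eq_0[THEN iffD2])
    show "AE \<omega> in M. \<omega> \<notin> (\<Inter>n. S n)"
      using starts_at_0 cadlag_paths
    proof eventually_elim
      case (elim \<omega>)
      then have "((\<lambda>v. X v \<omega>) \<longlongrightarrow> 0) (at_right 0)"
        by (auto simp: cadlag_def dest: spec[of _ 0])
      then have "\<forall>\<^sub>F v in at_right 0. norm (X v \<omega>) < r / 2"
        using tendstoD[of _ 0 _ "r / 2"] \<open>0 < r\<close> by fastforce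
      then obtain b where b: "0 < b" "\<And>v. 0 < v \<Longrightarrow> v < b \<Longrightarrow> norm (X v \<omega>) < r / 2"
        by (auto simp: eventually_at_right_field)
      obtain n where n: "1 / real (Suc n) < b"
        using \<open>0 < b\<close> nat_approx_posE by blast
      have "norm (X v \<omega>) < r / 2" if "0 \<le> v" "v < 1 / real (Suc n)" for v
        using b(2)[of v] that n elim \<open>0 < r\<close> by (cases "v = 0") auto
      then have "\<omega> \<notin> S n"
        by (fastforce simp: S_def)
      then show ?case by blast
    qed
  qed (use S in auto)
  ultimately have "\<forall>\<^sub>F n in sequentially. prob (S n) < e"
    using \<open>0 < e\<close> order_tendstoD(2) by fastforce
  then obtain n where n: "prob (S n) < e"
    by (auto simp: eventually_sequentially)
  have "AE \<omega> in M. \<omega> \<notin> S n \<longrightarrow> (\<forall>v\<in>{0..<1 / real (Suc n)}. norm (X v \<omega>) < r)"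
    using cadlag_paths AE_space
  proof eventually_elim
    case (elim \<omega>)
    have "norm (X v \<omega>) < r" if v: "\<omega> \<notin> S n" "v \<in> {0..<1 / real (Suc n)}" for v
    proof (rule ccontr)
      assume "\<not> norm (X v \<omega>) < r"
      then have "r / 2 < norm (X v \<omega>)"
        using \<open>0 < r\<close> by simp
      \<comment> \<open>Right continuity at \<open>v\<close> carries the norm above
        \<open>r / 2\<close> over to a rational \<open>w\<close> just after \<open>v\<close>, still
        before \<open>1 / Suc n\<close>.\<close>
      moreover have "((\<lambda>v. norm (X v \<omega>)) \<longlongrightarrow> norm (X v \<omega>)) (at_right v)"
        using elim that by (intro tendsto_norm) (auto simp: cadlag_def)
      ultimately have "\<forall>\<^sub>F w in at_right v. r / 2 < norm (X w \<omega>)"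
        by (rule order_tendstoD(1)[rotated])
      then obtain b where b: "v < b" "\<And>w. v < w \<Longrightarrow> w < b \<Longrightarrow> r / 2 < norm (X w \<omega>)"
        by (auto simp: eventually_at_right_field)
      obtain w where w: "w \<in> \<rat>" "v < w" "w < min b (1 / real (Suc n))"
        using Rats_dense_in_real[of v "min b (1 / real (Suc n))"] b v
        by (auto simp del: of_nat_Suc)
      then have "w \<in> \<rat> \<inter> {0..<1 / real (Suc n)}" "r / 2 < norm (X w \<omega>)"
        using b v by (auto simp del: of_nat_Suc)
      then have "\<omega> \<in> S n"
        using elim unfolding S_def by blast
      with v show False by simp
    qed
    then show ?case by blast
  qed
  then show ?thesis
    using that[of "1 / real (Suc n)" "S n"] S n by auto
qed


section \<open>Fubini, and the Markov property at the first grid exit\<close>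

context measurable_levy_process
begin

lemma measurable_X[measurable (raw)]:
  assumes "h \<in> measurable N M" "g \<in> borel_measurable N"
  shows "(\<lambda>z. X (g z) (h z)) \<in> borel_measurable N"
proof -
  have "(\<lambda>z. (h z, g z)) \<in> measurable N (M \<Otimes>\<^sub>M borel)"
    using assms by measurable
  from measurable_compose[OF this jointly_measurable] show ?thesis
    by simp
qed

lemma expectation_from_integral:
  fixes g :: "real \<times> 'a \<Rightarrow> ennreal"
  assumes [measurable]: "g \<in> borel_measurable borel"
  shows "expectation_from M X x (\<lambda>Y. \<integral>\<^sup>+u\<in>{0..t}. g (u, Y u) \<partial>lborel) =
    (\<integral>\<^sup>+u\<in>{0..t}. (\<integral>\<^sup>+\<omega>. g (u, X u \<omega> + x) \<partial>M) \<partial>lborel)"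
proof -
  interpret pair_sigma_finite M lborel ..
  have "(\<integral>\<^sup>+\<omega>. \<integral>\<^sup>+u. g (u, X u \<omega> + x) * indicator {0..t} u \<partial>lborel \<partial>M) =
      (\<integral>\<^sup>+u. \<integral>\<^sup>+\<omega>. g (u, X u \<omega> + x) * indicator {0..t} u \<partial>M \<partial>lborel)"
    by (rule Fubini'[symmetric]) measurable
  then show ?thesis
    by (simp add: expectation_from_def nn_integral_multc)
qed

text \<open>The event of first being outside the ball at the \<open>k\<close>-th grid time is
  determined by the first \<open>k\<close> grid increments, so the Markov property at the fixed time
  \<open>k * \<delta>\<close> applies to it.\<close>

lemma expectation_markov:
  fixes f :: "real \<times> 'a \<Rightarrow> ennreal"
  assumes [measurable]: "f \<in> borel_measurable borel"
    and \<delta>: "0 < \<delta>" "real k * \<delta> \<le> u"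
    and A: "A = {\<omega> \<in> space M. (\<forall>j<k. norm (X (real j * \<delta>) \<omega>) < r) \<and> r \<le> norm (X (real k * \<delta>) \<omega>)}"
  shows "(\<integral>\<^sup>+\<omega>. indicator A \<omega> * f (s + u, X u \<omega> + x) \<partial>M) =
    (\<integral>\<^sup>+\<omega>. indicator A \<omega> *
      (\<integral>\<^sup>+\<omega>'. f (s + u, X (u - real k * \<delta>) \<omega>' + (X (real k * \<delta>) \<omega> + x)) \<partial>M) \<partial>M)"
proof -
  let ?t = "\<lambda>i. real i * \<delta>" and ?P = "\<Pi>\<^sub>M i\<in>{..<k}. (borel :: 'a measure)"
  let ?V = "\<lambda>\<omega>. \<lambda>i\<in>{..<k}. X (?t (Suc i)) \<omega> - X (?t i) \<omega>"
  \<comment> \<open>The exit event rewritten for a vector of increments: its partial sums are the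
    grid positions, because the path starts at 0.\<close>
  let ?exit = "\<lambda>v::nat \<Rightarrow> 'a. (\<forall>j\<in>{..<k}. norm (\<Sum>i<j. v i) < r) \<and> r \<le> norm (\<Sum>i<k. v i)"
  define g where "g v w = (if ?exit v then f (s + u, w + ((\<Sum>i<k. v i) + x)) else 0)" for v w
  have [measurable]: "(\<lambda>v. \<Sum>i<j. v i) \<in> borel_measurable ?P" if "j \<le> k" for j
    using that by (intro borel_measurable_sum measurable_component_singleton) auto
  have exit [measurable]: "Measurable.pred ?P ?exit"
    by (intro pred_intros_logic pred_intros_finite) auto
  have g: "case_prod g \<in> borel_measurable (?P \<Otimes>\<^sub>M borel)"
    unfolding g_def[abs_def] by measurable
  have V: "(\<Sum>i<j. ?V \<omega> i) = X (?t j) \<omega>" if "j \<le> k" for j \<omega>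
  proof -
    have "(\<Sum>i<j. ?V \<omega> i) = (\<Sum>i<j. X (?t (Suc i)) \<omega> - X (?t i) \<omega>)"
      using that by (intro sum.cong) auto
    then show ?thesis
      by (simp only: sum_lessThan_telescope[of "\<lambda>i. X (?t i) \<omega>"]) (simp add: X_0)
  qed
  have gV: "g (?V \<omega>) w = indicator A \<omega> * f (s + u, w + (X (?t k) \<omega> + x))" if "\<omega> \<in> space M" for \<omega> w
    using that unfolding g_def A
    by (auto simp: V simp del: restrict_apply of_nat_Suc split: split_indicator)
  have "(\<integral>\<^sup>+\<omega>. g (?V \<omega>) (X u \<omega> - X (?t k) \<omega>) \<partial>M) =
      (\<integral>\<^sup>+\<omega>. \<integral>\<^sup>+\<omega>'. g (?V \<omega>) (X (u - ?t k) \<omega>') \<partial>M \<partial>M)"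
    using \<delta> g by (intro nn_integral_markov X_0) auto
  also have "(\<integral>\<^sup>+\<omega>. g (?V \<omega>) (X u \<omega> - X (?t k) \<omega>) \<partial>M) =
      (\<integral>\<^sup>+\<omega>. indicator A \<omega> * f (s + u, X u \<omega> + x) \<partial>M)"
    by (intro nn_integral_cong) (simp add: gV del: of_nat_Suc)
  also have "(\<integral>\<^sup>+\<omega>. \<integral>\<^sup>+\<omega>'. g (?V \<omega>) (X (u - ?t k) \<omega>') \<partial>M \<partial>M) =
      (\<integral>\<^sup>+\<omega>. indicator A \<omega> * (\<integral>\<^sup>+\<omega>'. f (s + u, X (u - ?t k) \<omega>' + (X (?t k) \<omega> + x)) \<partial>M) \<partial>M)"
    by (intro nn_integral_cong) (simp add: gV nn_integral_cmult del: of_nat_Suc)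
  finally show ?thesis .
qed

text \<open>This is the transition semigroup of the space-time process
  \<open>(s + u, X u + x)\<close>, applied to \<open>f\<close>.\<close>

definition mean :: "(real \<times> 'a \<Rightarrow> ennreal) \<Rightarrow> real \<Rightarrow> 'a \<Rightarrow> real \<Rightarrow> ennreal" where
  "mean f s x u = (\<integral>\<^sup>+\<omega>. f (s + u, X u \<omega> + x) \<partial>M)"

lemma measurable_mean[measurable (raw)]:
  assumes [measurable]: "f \<in> borel_measurable borel" "g \<in> borel_measurable N" "h \<in> borel_measurable N"
  shows "(\<lambda>z. mean f s (g z) (h z)) \<in> borel_measurable N"
  unfolding mean_def by measurable

section \<open>Decomposition at the first exit seen on the grid\<close>

text \<open>Three cases at time \<open>u\<close>: the exit has been noticed at some grid time
  \<open>k * \<delta> \<le> u\<close>, and the process restarts there; or it has not, and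
  \<open>X u\<close> is still within \<open>2 * r\<close>; or the path has moved by at least
  \<open>r\<close> since the last grid time, which costs at most
  \<open>c * \<epsilon>\<close>.\<close>

lemma mean_le_first_exit:
  fixes f :: "real \<times> 'a \<Rightarrow> ennreal"
  assumes f [measurable]: "f \<in> borel_measurable borel" and c: "\<And>p. f p \<le> c"
    and \<delta>: "0 < \<delta>" and u: "0 \<le> u" "u \<le> real N * \<delta>"
    and \<epsilon>: "\<And>v. 0 \<le> v \<Longrightarrow> v \<le> \<delta> \<Longrightarrow> emeasure M {\<omega> \<in> space M. r \<le> norm (X v \<omega>)} \<le> \<epsilon>"
    and A: "\<And>k. A k =
      {\<omega> \<in> space M. (\<forall>j<k. norm (X (real j * \<delta>) \<omega>) < r) \<and> r \<le> norm (X (real k * \<delta>) \<omega>)}"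
  shows "mean f s x u \<le> (\<integral>\<^sup>+\<omega>. indicator (ball 0 (2 * r)) (X u \<omega>) * f (s + u, X u \<omega> + x) \<partial>M) + c * \<epsilon> +
    (\<Sum>k\<le>N. indicator {real k * \<delta>..} u *
      (\<integral>\<^sup>+\<omega>. indicator (A k) \<omega> *
        mean f (s + real k * \<delta>) (X (real k * \<delta>) \<omega> + x) (u - real k * \<delta>) \<partial>M))"
proof -
  have [measurable]: "ball (0 :: 'a) (2 * r) \<in> sets borel"
    by simp
  have [measurable]: "A k \<in> sets M" for k
    unfolding A by measurable
  \<comment> \<open>The index of the last grid time not exceeding \<open>u\<close>.\<close>
  define m where "m = nat \<lfloor>u / \<delta>\<rfloor>"
  have "real m = of_int \<lfloor>u / \<delta>\<rfloor>"
    using u \<delta> by (simp add: m_def)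
  then have "real m \<le> u / \<delta>" "u / \<delta> < real m + 1"
    by linarith+
  then have m: "real m * \<delta> \<le> u" "u < real m * \<delta> + \<delta>"
    using \<delta> by (auto simp: field_simps)
  then have "real m * \<delta> \<le> real N * \<delta>"
    using u by linarith
  then have "m \<le> N"
    using \<delta> by simp
  let ?near = "\<lambda>\<omega>. indicator (ball 0 (2 * r)) (X u \<omega>) * f (s + u, X u \<omega> + x)"
  let ?D = "{\<omega> \<in> space M. r \<le> norm (X u \<omega> - X (real m * \<delta>) \<omega>)}"
  define exit where
    "exit k \<omega> = indicator {real k * \<delta>..} u * (indicator (A k) \<omega> * f (s + u, X u \<omega> + x))" for k \<omega>
  have [measurable]: "exit k \<in> borel_measurable M" for k
    unfolding exit_def[abs_def] by measurable
  have "mean f s x u \<le> (\<integral>\<^sup>+\<omega>. ?near \<omega> + c * indicator ?D \<omega> + (\<Sum>k\<le>N. exit k \<omega>) \<partial>M)"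
    unfolding mean_def
  proof (rule nn_integral_mono)
    fix \<omega> assume \<omega>: "\<omega> \<in> space M"
    show "f (s + u, X u \<omega> + x) \<le> ?near \<omega> + c * indicator ?D \<omega> + (\<Sum>k\<le>N. exit k \<omega>)"
    proof (cases "\<exists>j\<le>m. r \<le> norm (X (real j * \<delta>) \<omega>)")
      case True
      \<comment> \<open>The first grid index at which the path is outside; minimality puts \<omega>
        into \<open>A k\<close>.\<close>
      define k where "k = (LEAST j. r \<le> norm (X (real j * \<delta>) \<omega>))"
      obtain j where j: "j \<le> m" "r \<le> norm (X (real j * \<delta>) \<omega>)"
        using True by blast
      then have "k \<le> m"
        unfolding k_def by (meson Least_le order_trans)
      then have "real k * \<delta> \<le> real m * \<delta>"
        using \<delta> by simp
      then have ku: "real k * \<delta> \<le> u"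
        using m by linarith
      have "\<omega> \<in> A k"
        unfolding A using \<omega> LeastI[of "\<lambda>j. r \<le> norm (X (real j * \<delta>) \<omega>)", OF j(2)]
          not_less_Least[of _ "\<lambda>j. r \<le> norm (X (real j * \<delta>) \<omega>)"]
        by (auto simp: k_def not_le)
      then have "f (s + u, X u \<omega> + x) = exit k \<omega>"
        using ku by (simp add: exit_def)
      also have "\<dots> \<le> (\<Sum>k\<le>N. exit k \<omega>)"
        using \<open>k \<le> m\<close> \<open>m \<le> N\<close> by (intro member_le_sum) auto
      finally show ?thesis
        by (simp add: add_increasing)
    next
      case False
      then have "norm (X (real m * \<delta>) \<omega>) < r"
        by force
      then have "norm (X u \<omega>) < 2 * r \<or> r \<le> norm (X u \<omega> - X (real m * \<delta>) \<omega>)"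
        using norm_triangle_sub[of "X u \<omega>" "X (real m * \<delta>) \<omega>"] by linarith
      then show ?thesis
      proof
        assume "norm (X u \<omega>) < 2 * r"
        then show ?thesis
          by (simp add: add_increasing2)
      next
        assume "r \<le> norm (X u \<omega> - X (real m * \<delta>) \<omega>)"
        then have "f (s + u, X u \<omega> + x) \<le> c * indicator ?D \<omega>"
          using \<omega> c by simp
        then show ?thesis
          by (simp add: add_increasing add_increasing2)
      qed
    qed
  qed
  also have "\<dots> = (\<integral>\<^sup>+\<omega>. ?near \<omega> \<partial>M) + c * emeasure M ?D + (\<Sum>k\<le>N. \<integral>\<^sup>+\<omega>. exit k \<omega> \<partial>M)"
  proof -
    have "(\<integral>\<^sup>+\<omega>. ?near \<omega> + c * indicator ?D \<omega> + (\<Sum>k\<le>N. exit k \<omega>) \<partial>M) =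
        (\<integral>\<^sup>+\<omega>. ?near \<omega> + c * indicator ?D \<omega> \<partial>M) + (\<integral>\<^sup>+\<omega>. (\<Sum>k\<le>N. exit k \<omega>) \<partial>M)"
      by (rule nn_integral_add; measurable)
    also have "(\<integral>\<^sup>+\<omega>. ?near \<omega> + c * indicator ?D \<omega> \<partial>M) =
        (\<integral>\<^sup>+\<omega>. ?near \<omega> \<partial>M) + (\<integral>\<^sup>+\<omega>. c * indicator ?D \<omega> \<partial>M)"
      by (rule nn_integral_add; measurable)
    finally show ?thesis
      by (simp add: nn_integral_sum nn_integral_cmult)
  qed
  also have "\<dots> \<le> (\<integral>\<^sup>+\<omega>. ?near \<omega> \<partial>M) + c * \<epsilon> + (\<Sum>k\<le>N. indicator {real k * \<delta>..} u *
      (\<integral>\<^sup>+\<omega>. indicator (A k) \<omega> *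
        mean f (s + real k * \<delta>) (X (real k * \<delta>) \<omega> + x) (u - real k * \<delta>) \<partial>M))"
  proof (intro add_mono order_refl mult_left_mono sum_mono)
    \<comment> \<open>Stationarity turns the increment since the last grid time into
      \<open>X\<close> at a time below \<delta>, where the hypothesis on \<epsilon> applies.\<close>
    have law: "distr M borel (\<lambda>\<omega>. X u \<omega> - X (real m * \<delta>) \<omega>) = distr M borel (X (u - real m * \<delta>))"
      using stationary_increments[of "real m * \<delta>" "u - real m * \<delta>"] m \<delta> by simp
    have "emeasure M ?D = emeasure (distr M borel (\<lambda>\<omega>. X u \<omega> - X (real m * \<delta>) \<omega>)) {y. r \<le> norm y}"
      by (subst emeasure_distr) (auto intro!: arg_cong[where f = "emeasure M"])
    also have "\<dots> = emeasure M {\<omega> \<in> space M. r \<le> norm (X (u - real m * \<delta>) \<omega>)}"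
      unfolding law by (subst emeasure_distr) (auto intro!: arg_cong[where f = "emeasure M"])
    also have "\<dots> \<le> \<epsilon>"
      using m by (intro \<epsilon>) auto
    finally show "emeasure M ?D \<le> \<epsilon>" .
    show "(\<integral>\<^sup>+\<omega>. exit k \<omega> \<partial>M) \<le> indicator {real k * \<delta>..} u *
      (\<integral>\<^sup>+\<omega>. indicator (A k) \<omega> *
        mean f (s + real k * \<delta>) (X (real k * \<delta>) \<omega> + x) (u - real k * \<delta>) \<partial>M)" for k
    proof (cases "real k * \<delta> \<le> u")
      case True
      then show ?thesis
        using expectation_markov[OF f \<delta> True A[of k], of s x]
        by (simp add: mean_def add.assoc exit_def)
    qed (simp add: exit_def)
  qed simp
  finally show ?thesis .
qed

text \<open>After a restart at \<open>k * \<delta>\<close> at most time \<open>T\<close> remains, so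
  each exit event contributes at most \<open>G\<close> times its probability. The exit events are
  disjoint and almost surely contained in \<open>S\<close>.\<close>

lemma integral_mean_le_first_exit:
  fixes f :: "real \<times> 'a \<Rightarrow> ennreal"
  assumes f [measurable]: "f \<in> borel_measurable borel" and c: "\<And>p. f p \<le> c"
    and \<delta>: "0 < \<delta>" and T: "T = real N * \<delta>"
    and \<epsilon>: "\<And>v. 0 \<le> v \<Longrightarrow> v \<le> \<delta> \<Longrightarrow> emeasure M {\<omega> \<in> space M. r \<le> norm (X v \<omega>)} \<le> \<epsilon>"
    and S: "S \<in> events" "AE \<omega> in M. \<omega> \<notin> S \<longrightarrow> (\<forall>v\<in>{0..T}. norm (X v \<omega>) < r)"
    and G: "\<And>s x. (\<integral>\<^sup>+u\<in>{0..T}. mean f s x u \<partial>lborel) \<le> G"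
  shows "(\<integral>\<^sup>+u\<in>{0..T}. mean f s x u \<partial>lborel) \<le>
    (\<integral>\<^sup>+u\<in>{0..T}. (\<integral>\<^sup>+\<omega>. indicator (ball 0 (2 * r)) (X u \<omega>) * f (s + u, X u \<omega> + x) \<partial>M) \<partial>lborel) +
    c * \<epsilon> * ennreal T + G * emeasure M S"
proof -
  interpret pair_sigma_finite M lborel ..
  define A where "A k =
    {\<omega> \<in> space M. (\<forall>j<k. norm (X (real j * \<delta>) \<omega>) < r) \<and> r \<le> norm (X (real k * \<delta>) \<omega>)}" for k
  have [measurable]: "ball (0 :: 'a) (2 * r) \<in> sets borel"
    by simp
  have [measurable]: "A k \<in> sets M" for k
    unfolding A_def by measurable
  let ?near = "\<lambda>u. \<integral>\<^sup>+\<omega>. indicator (ball 0 (2 * r)) (X u \<omega>) * f (s + u, X u \<omega> + x) \<partial>M"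
  let ?mean = "\<lambda>k \<omega> u. mean f (s + real k * \<delta>) (X (real k * \<delta>) \<omega> + x) (u - real k * \<delta>)"
  define exit where
    "exit k u =
      indicator {real k * \<delta>..} u * (\<integral>\<^sup>+\<omega>. indicator (A k) \<omega> * ?mean k \<omega> u \<partial>M) * indicator {0..T} u" for k u
  have [measurable]: "exit k \<in> borel_measurable borel" for k
    unfolding exit_def[abs_def] by measurable
  have T0: "0 \<le> T"
    using T \<delta> by simp
  have "(\<integral>\<^sup>+u\<in>{0..T}. mean f s x u \<partial>lborel) \<le>
      (\<integral>\<^sup>+u. ?near u * indicator {0..T} u + c * \<epsilon> * indicator {0..T} u +
        (\<Sum>k\<le>N. exit k u) \<partial>lborel)"
  proof (rule nn_integral_mono)
    fix u :: real
    show "mean f s x u * indicator {0..T} u \<le> ?near u * indicator {0..T} u + c * \<epsilon> * indicator {0..T} u +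
        (\<Sum>k\<le>N. exit k u)"
      using mean_le_first_exit[OF f c \<delta> _ _ \<epsilon> A_def, where u = u and N = N and s = s and x = x] T
      by (cases "u \<in> {0..T}") (simp_all add: add.assoc exit_def)
  qed
  also have "\<dots> = (\<integral>\<^sup>+u\<in>{0..T}. ?near u \<partial>lborel) + c * \<epsilon> * ennreal T +
      (\<Sum>k\<le>N. \<integral>\<^sup>+u. exit k u \<partial>lborel)"
  proof -
    have "(\<integral>\<^sup>+u. ?near u * indicator {0..T} u + c * \<epsilon> * indicator {0..T} u + (\<Sum>k\<le>N. exit k u) \<partial>lborel) =
        (\<integral>\<^sup>+u. ?near u * indicator {0..T} u + c * \<epsilon> * indicator {0..T} u \<partial>lborel) +
        (\<integral>\<^sup>+u. (\<Sum>k\<le>N. exit k u) \<partial>lborel)"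
      by (rule nn_integral_add; measurable)
    also have "(\<integral>\<^sup>+u. ?near u * indicator {0..T} u + c * \<epsilon> * indicator {0..T} u \<partial>lborel) =
        (\<integral>\<^sup>+u\<in>{0..T}. ?near u \<partial>lborel) + (\<integral>\<^sup>+u. c * \<epsilon> * indicator {0..T} u \<partial>lborel)"
      by (rule nn_integral_add; measurable)
    finally show ?thesis
      using T0 by (simp add: nn_integral_sum nn_integral_cmult)
  qed
  also have "(\<Sum>k\<le>N. \<integral>\<^sup>+u. exit k u \<partial>lborel) \<le> (\<Sum>k\<le>N. G * emeasure M (A k))"
  proof (rule sum_mono)
    fix k
    let ?a = "real k * \<delta>"
    have "(\<integral>\<^sup>+u. exit k u \<partial>lborel) =
        (\<integral>\<^sup>+u. \<integral>\<^sup>+\<omega>. indicator (A k) \<omega> * (indicator {?a..} u * indicator {0..T} u * ?mean k \<omega> u) \<partial>M \<partial>lborel)"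
    proof (rule nn_integral_cong)
      fix u :: real
      show "exit k u =
        (\<integral>\<^sup>+\<omega>. indicator (A k) \<omega> * (indicator {?a..} u * indicator {0..T} u * ?mean k \<omega> u) \<partial>M)"
        by (simp add: exit_def split: split_indicator)
    qed
    also have "\<dots> =
        (\<integral>\<^sup>+\<omega>. \<integral>\<^sup>+u. indicator (A k) \<omega> * (indicator {?a..} u * indicator {0..T} u * ?mean k \<omega> u) \<partial>lborel \<partial>M)"
      by (rule Fubini') measurable
    also have "\<dots> =
        (\<integral>\<^sup>+\<omega>. indicator (A k) \<omega> * (\<integral>\<^sup>+u. indicator {?a..} u * indicator {0..T} u * ?mean k \<omega> u \<partial>lborel) \<partial>M)"
      by (intro nn_integral_cong nn_integral_cmult) measurable
    also have "\<dots> \<le> (\<integral>\<^sup>+\<omega>. indicator (A k) \<omega> * G \<partial>M)"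
    proof (intro nn_integral_mono mult_left_mono)
      fix \<omega> assume [measurable]: "\<omega> \<in> space M"
      \<comment> \<open>The substitution \<open>u = ?a + v\<close> restarts the clock; as
        \<open>?a \<ge> 0\<close>, the remaining times \<open>v\<close> lie in
        \<open>{0..T}\<close>.\<close>
      have "(\<integral>\<^sup>+u. indicator {?a..} u * indicator {0..T} u * ?mean k \<omega> u \<partial>lborel) =
          (\<integral>\<^sup>+v. indicator {?a..} (?a + v) * indicator {0..T} (?a + v) * ?mean k \<omega> (?a + v) \<partial>lborel)"
        by (subst nn_integral_real_affine[where c = 1 and t = ?a]) simp_all
      also have "\<dots> \<le> (\<integral>\<^sup>+v\<in>{0..T}. mean f (s + ?a) (X ?a \<omega> + x) v \<partial>lborel)"
        using mult_nonneg_nonneg[of "real k" \<delta>] \<delta>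
        by (intro nn_integral_mono) (auto split: split_indicator simp del: mult_nonneg_nonneg)
      also have "\<dots> \<le> G"
        by (rule G)
      finally show "(\<integral>\<^sup>+u. indicator {?a..} u * indicator {0..T} u * ?mean k \<omega> u \<partial>lborel) \<le> G" .
    qed simp
    also have "\<dots> = G * emeasure M (A k)"
      using nn_integral_cmult_indicator[of "A k" M G] by (simp add: mult.commute)
    finally show "(\<integral>\<^sup>+u. exit k u \<partial>lborel) \<le> G * emeasure M (A k)" .
  qed
  also have "(\<Sum>k\<le>N. G * emeasure M (A k)) = G * emeasure M (\<Union>k\<le>N. A k)"
  proof -
    \<comment> \<open>At the smaller of two exit indices the path would have to be both outside and
      inside the ball.\<close>
    have "disjoint_family_on A {..N}"
      unfolding disjoint_family_on_def
    proof (intro ballI impI)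
      fix j k :: nat assume "j \<noteq> k"
      then show "A j \<inter> A k = {}"
        by (cases j k rule: linorder_cases) (auto simp: A_def)
    qed
    then have "(\<Sum>k\<le>N. emeasure M (A k)) = emeasure M (\<Union>k\<le>N. A k)"
      by (intro sum_emeasure) auto
    then show ?thesis
      by (simp add: sum_distrib_left[symmetric])
  qed
  also have "\<dots> \<le> G * emeasure M S"
  proof (intro mult_left_mono emeasure_mono_AE S)
    show "AE \<omega> in M. \<omega> \<in> (\<Union>k\<le>N. A k) \<longrightarrow> \<omega> \<in> S"
      using S(2)
    proof eventually_elim
      case (elim \<omega>)
      have "\<omega> \<in> S" if "k \<le> N" "\<omega> \<in> A k" for k
      proof (rule ccontr)
        assume "\<omega> \<notin> S"
        moreover have "real k * \<delta> \<in> {0..T}"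
          using that \<delta> T by simp
        ultimately have "norm (X (real k * \<delta>) \<omega>) < r"
          using elim by blast
        with that show False
          by (simp add: A_def)
      qed
      then show ?case by blast
    qed
  qed simp
  finally show ?thesis
    by (simp add: add_left_mono)
qed

section \<open>Absorbing the global supremum, first for bounded functions\<close>

text \<open>Letting the mesh tend to 0 in the first-exit estimate yields
  \<open>G \<le> K + G / 2\<close>. Boundedness enters twice: it makes the grid error vanish, and it
  makes \<open>G\<close> finite, so that \<open>G / 2\<close> may be subtracted.\<close>

lemma bounded_integral_mean_le:
  fixes f :: "real \<times> 'a \<Rightarrow> ennreal"
  assumes f [measurable]: "f \<in> borel_measurable borel" and C: "\<And>p. f p \<le> ennreal C" "0 \<le> C"
    and r: "0 < r" and T: "0 < T"
    and S: "S \<in> events" "prob S \<le> 1 / 2" "AE \<omega> in M. \<omega> \<notin> S \<longrightarrow> (\<forall>v\<in>{0..T}. norm (X v \<omega>) < r)"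
    and K: "\<And>s x. (\<integral>\<^sup>+u\<in>{0..T}.
      (\<integral>\<^sup>+\<omega>. indicator (ball 0 (2 * r)) (X u \<omega>) * f (s + u, X u \<omega> + x) \<partial>M) \<partial>lborel) \<le> K"
  shows "(\<integral>\<^sup>+u\<in>{0..T}. mean f s x u \<partial>lborel) \<le> 2 * K"
proof -
  define G where "G = (SUP (s, x) \<in> UNIV. \<integral>\<^sup>+u\<in>{0..T}. mean f s x u \<partial>lborel)"
  have le_G: "(\<integral>\<^sup>+u\<in>{0..T}. mean f s x u \<partial>lborel) \<le> G" for s x
    unfolding G_def by (rule SUP_upper2[of "(s, x)"]) auto
  have mean_le: "mean f s x u \<le> ennreal C" for s x u
  proof -
    have "mean f s x u \<le> (\<integral>\<^sup>+\<omega>. ennreal C \<partial>M)"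
      unfolding mean_def by (intro nn_integral_mono C)
    then show ?thesis
      by (simp add: emeasure_space_1)
  qed
  have "G \<le> ennreal C * ennreal T"
    unfolding G_def
  proof (intro SUP_least, clarify)
    fix s x
    have "(\<integral>\<^sup>+u\<in>{0..T}. mean f s x u \<partial>lborel) \<le> (\<integral>\<^sup>+u\<in>{0..T}. ennreal C \<partial>lborel)"
      by (intro nn_integral_mono mult_right_mono mean_le) simp
    then show "(\<integral>\<^sup>+u\<in>{0..T}. mean f s x u \<partial>lborel) \<le> ennreal C * ennreal T"
      using T by (simp add: nn_integral_cmult)
  qed
  also have "\<dots> < \<infinity>"
    by (simp add: ennreal_mult_less_top)
  finally obtain g where g: "G = ennreal g" "0 \<le> g"
    by (cases G) auto
  show ?thesis
  proof (cases K)
    case (real k)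
    have "g \<le> k + g / 2 + e" if "0 < e" for e
    proof -
      \<comment> \<open>Chosen so that the grid error \<open>C * ?\<epsilon> * T\<close> is at most
        \<open>e\<close>; the summand 1 keeps the denominator positive when
        \<open>C = 0\<close>.\<close>
      let ?\<epsilon> = "e / (C * T + 1)"
      have pos: "0 < C * T + 1"
        using C T by (simp add: add_nonneg_pos)
      then have "0 < ?\<epsilon>"
        using \<open>0 < e\<close> by simp
      then have nonneg: "0 \<le> C * ?\<epsilon> * T"
        using C T by (intro mult_nonneg_nonneg) auto
      from r \<open>0 < ?\<epsilon>\<close> obtain S' \<delta>' where S': "0 < \<delta>'" "S' \<in> events" "prob S' \<le> ?\<epsilon>"
        "AE \<omega> in M. \<omega> \<notin> S' \<longrightarrow> (\<forall>v\<in>{0..<\<delta>'}. norm (X v \<omega>) < r)"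
        by (rule small_oscillation)
      obtain N where N: "1 / real (Suc N) < \<delta>' / T"
        using nat_approx_posE[of "\<delta>' / T"] S' T by auto
      \<comment> \<open>The mesh divides \<open>T\<close> exactly and is strictly below
        \<open>\<delta>'\<close>, so the closed interval \<open>{0..\<delta>}\<close> lies in
        \<open>{0..<\<delta>'}\<close>.\<close>
      define \<delta> where "\<delta> = T / real (Suc N)"
      have \<delta>: "0 < \<delta>" "\<delta> < \<delta>'" "T = real (Suc N) * \<delta>"
        using N T by (auto simp: \<delta>_def field_simps)
      have small: "emeasure M {\<omega> \<in> space M. r \<le> norm (X v \<omega>)} \<le> ennreal ?\<epsilon>" if "0 \<le> v" "v \<le> \<delta>" for v
      proof -
        have "emeasure M {\<omega> \<in> space M. r \<le> norm (X v \<omega>)} \<le> emeasure M S'"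
          using S'(4) by (intro emeasure_mono_AE S') 
            (auto elim!: eventually_mono dest!: bspec[of _ _ v] simp: that le_less_trans[OF that(2) \<delta>(2)])
        then show ?thesis
          using S'(3) by (simp add: emeasure_eq_measure order_trans ennreal_leI)
      qed
      have "G \<le> K + ennreal C * ennreal ?\<epsilon> * ennreal T + G * emeasure M S"
        unfolding G_def SUP_le_iff
      proof (clarify, fold G_def)
        fix s x
        show "(\<integral>\<^sup>+u\<in>{0..T}. mean f s x u \<partial>lborel) \<le>
            K + ennreal C * ennreal ?\<epsilon> * ennreal T + G * emeasure M S"
          using integral_mean_le_first_exit[OF f C(1) \<delta>(1) \<delta>(3) small S(1) S(3) le_G, of s x] K[of s x]
          by (meson add_mono order_refl order_trans)
      qed
      also have "\<dots> \<le> ennreal k + ennreal (C * ?\<epsilon> * T) + ennreal g * ennreal (1 / 2)"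
      proof (intro add_mono)
        show "ennreal C * ennreal ?\<epsilon> * ennreal T \<le> ennreal (C * ?\<epsilon> * T)"
          using C T \<open>0 < ?\<epsilon>\<close> by (simp only: ennreal_mult' mult_nonneg_nonneg less_imp_le order_refl)
        show "G * emeasure M S \<le> ennreal g * ennreal (1 / 2)"
          unfolding g(1) emeasure_eq_measure using S(2) by (intro mult_left_mono ennreal_leI) auto
      qed (simp add: real)
      also have "\<dots> = ennreal (k + C * ?\<epsilon> * T + g / 2)"
        unfolding ennreal_mult'[OF g(2), symmetric] using nonneg g real by (simp add: ennreal_plus)
      finally have "g \<le> k + C * ?\<epsilon> * T + g / 2"
        using nonneg g real by (subst (asm) g(1), subst (asm) ennreal_le_iff) auto
      moreover have "C * ?\<epsilon> * T \<le> e"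
        using pos \<open>0 < e\<close> by (simp add: field_simps)
      ultimately show ?thesis
        by simp
    qed
    then have "g \<le> k + g / 2"
      by (rule field_le_epsilon)
    then have "ennreal g \<le> ennreal (2 * k)"
      by (intro ennreal_leI) simp
    then have "G \<le> 2 * K"
      using g(1) real by (simp add: ennreal_mult')
    with le_G show ?thesis
      by (rule order_trans)
  qed (simp add: ennreal_mult_top)
qed

text \<open>The bound \<open>2 * K\<close> does not depend on the bound of the function, so it
  survives monotone convergence along the truncations \<open>min (f p) n\<close>.\<close>

lemma integral_mean_le:
  fixes f :: "real \<times> 'a \<Rightarrow> ennreal"
  assumes f [measurable]: "f \<in> borel_measurable borel"
    and r: "0 < r" and T: "0 < T"
    and S: "S \<in> events" "prob S \<le> 1 / 2" "AE \<omega> in M. \<omega> \<notin> S \<longrightarrow> (\<forall>v\<in>{0..T}. norm (X v \<omega>) < r)"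
    and K: "\<And>s x. (\<integral>\<^sup>+u\<in>{0..T}.
      (\<integral>\<^sup>+\<omega>. indicator (ball 0 (2 * r)) (X u \<omega>) * f (s + u, X u \<omega> + x) \<partial>M) \<partial>lborel) \<le> K"
  shows "(\<integral>\<^sup>+u\<in>{0..T}. mean f s x u \<partial>lborel) \<le> 2 * K"
proof -
  define g where "g n p = min (f p) (of_nat n)" for n p
  have [measurable]: "g n \<in> borel_measurable borel" for n
    unfolding g_def[abs_def] by measurable
  have g_mono: "g m p \<le> g n p" if "m \<le> n" for m n p
    unfolding g_def using that by (intro min.mono) auto
  have SUP_g: "(SUP n. g n p) = f p" for p
  proof (rule antisym)
    show "(SUP n. g n p) \<le> f p"
      by (intro SUP_least) (simp add: g_def)
    show "f p \<le> (SUP n. g n p)"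
    proof (cases "f p = \<top>")
      case True
      then show ?thesis
        by (simp add: g_def min_absorb2 ennreal_SUP_of_nat_eq_top)
    next
      case False
      then obtain n where "f p \<le> of_nat n"
        using ennreal_Ex_less_of_nat[of "f p"] by (auto simp: less_top intro: less_imp_le)
      then show ?thesis
        by (intro SUP_upper2[of n]) (auto simp: g_def)
    qed
  qed
  have mean_g_mono: "mean (g m) s x u \<le> mean (g n) s x u" if "m \<le> n" for m n u
    unfolding mean_def using g_mono[OF that] by (intro nn_integral_mono)
  have "mean f s x u = (SUP n. mean (g n) s x u)" for u
    unfolding mean_def SUP_g[symmetric]
    by (intro nn_integral_monotone_convergence_SUP) (auto simp: incseq_def le_fun_def g_mono)
  then have "(\<integral>\<^sup>+u\<in>{0..T}. mean f s x u \<partial>lborel) =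
      (\<integral>\<^sup>+u. (SUP n. mean (g n) s x u * indicator {0..T} u) \<partial>lborel)"
    by (simp add: SUP_mult_right_ennreal)
  also have "\<dots> = (SUP n. \<integral>\<^sup>+u\<in>{0..T}. mean (g n) s x u \<partial>lborel)"
    by (intro nn_integral_monotone_convergence_SUP)
       (auto simp: incseq_def le_fun_def intro!: mult_right_mono mean_g_mono)
  also have "\<dots> \<le> 2 * K"
  proof (intro SUP_least bounded_integral_mean_le[where C = "of_nat n" for n, OF _ _ _ r T S])
    fix n :: nat and p s x
    show "g n p \<le> ennreal (of_nat n)"
      by (simp add: g_def ennreal_of_nat_eq_real_of_nat)
    have "(\<integral>\<^sup>+u\<in>{0..T}.
        (\<integral>\<^sup>+\<omega>. indicator (ball 0 (2 * r)) (X u \<omega>) * g n (s + u, X u \<omega> + x) \<partial>M) \<partial>lborel) \<le>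
      (\<integral>\<^sup>+u\<in>{0..T}.
        (\<integral>\<^sup>+\<omega>. indicator (ball 0 (2 * r)) (X u \<omega>) * f (s + u, X u \<omega> + x) \<partial>M) \<partial>lborel)"
      by (intro nn_integral_mono mult_right_mono mult_left_mono) (auto simp: g_def)
    also have "\<dots> \<le> K"
      by (rule K)
    finally show "(\<integral>\<^sup>+u\<in>{0..T}.
        (\<integral>\<^sup>+\<omega>. indicator (ball 0 (2 * r)) (X u \<omega>) * g n (s + u, X u \<omega> + x) \<partial>M) \<partial>lborel) \<le> K" .
  qed auto
  finally show ?thesis .
qed

text \<open>The exit radius is \<open>r / 2\<close>, since the first-exit estimate localizes to
  twice the exit radius.\<close>

lemma SUP_expectation_le_local:
  fixes f :: "real \<times> 'a \<Rightarrow> ennreal"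
  assumes [measurable]: "f \<in> borel_measurable borel" and r: "0 < r"
  shows "\<forall>\<^sub>F t in at_right 0.
    (SUP (s, x) \<in> UNIV. expectation_from M X x (\<lambda>Y. \<integral>\<^sup>+u\<in>{0..t}. f (s + u, Y u) \<partial>lborel)) \<le>
    2 * (SUP (s, x) \<in> UNIV. expectation_from M X x
      (\<lambda>Y. \<integral>\<^sup>+u\<in>{0..r}. indicator (ball x r) (Y u) * f (s + u, Y u) \<partial>lborel))"
    (is "\<forall>\<^sub>F t in _. (SUP (s, x) \<in> UNIV. ?global t s x) \<le> 2 * (SUP (s, x) \<in> UNIV. ?local s x)")
proof -
  have [measurable]: "ball (x :: 'a) r \<in> sets borel" for x
    by simp
  have "0 < r / 2" "0 < (1 / 2 :: real)"
    using r by auto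
  then obtain S \<delta> where S: "0 < \<delta>" "S \<in> events" "prob S \<le> 1 / 2"
    "AE \<omega> in M. \<omega> \<notin> S \<longrightarrow> (\<forall>v\<in>{0..<\<delta>}. norm (X v \<omega>) < r / 2)"
    by (rule small_oscillation)
  \<comment> \<open>\<open>t < \<delta>\<close> makes an exit by time \<open>t\<close> have
    probability at most 1/2; \<open>t < r\<close> lets the local integral be extended to
    \<open>{0..r}\<close>.\<close>
  have "(SUP (s, x) \<in> UNIV. ?global t s x) \<le> 2 * (SUP (s, x) \<in> UNIV. ?local s x)"
    if t: "0 < t" "t < min \<delta> r" for t
  proof (intro SUP_least, clarify)
    fix s x
    have "(\<lambda>p. f (s + fst p, snd p)) \<in> borel_measurable borel"
      by (subst borel_prod[symmetric]) measurable
    then have "?global t s x = (\<integral>\<^sup>+u\<in>{0..t}. mean f s x u \<partial>lborel)"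
      using expectation_from_integral[of "\<lambda>p. f (s + fst p, snd p)" x t] by (simp add: mean_def)
    also have "\<dots> \<le> 2 * (SUP (s, x) \<in> UNIV. ?local s x)"
    proof (rule integral_mean_le[OF _ \<open>0 < r / 2\<close> \<open>0 < t\<close> S(2,3)])
      show "AE \<omega> in M. \<omega> \<notin> S \<longrightarrow> (\<forall>v\<in>{0..t}. norm (X v \<omega>) < r / 2)"
        using S(4) by eventually_elim (use t in auto)
      fix s x
      have "(\<integral>\<^sup>+u\<in>{0..t}.
          (\<integral>\<^sup>+\<omega>. indicator (ball 0 (2 * (r / 2))) (X u \<omega>) * f (s + u, X u \<omega> + x) \<partial>M) \<partial>lborel) \<le>
        (\<integral>\<^sup>+u\<in>{0..r}.
          (\<integral>\<^sup>+\<omega>. indicator (ball x r) (X u \<omega> + x) * f (s + u, X u \<omega> + x) \<partial>M) \<partial>lborel)"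
        using t by (intro nn_integral_mono mult_mono) (auto simp: dist_norm split: split_indicator)
      also have "\<dots> = ?local s x"
      proof -
        have "(\<lambda>p. indicator (ball x r) (snd p) * f (s + fst p, snd p)) \<in> borel_measurable borel"
          by (subst borel_prod[symmetric]) measurable
        from expectation_from_integral[OF this, of x r] show ?thesis
          by simp
      qed
      also have "\<dots> \<le> (SUP (s, x) \<in> UNIV. ?local s x)"
        by (rule SUP_upper2[of "(s, x)"]) auto
      finally show "(\<integral>\<^sup>+u\<in>{0..t}.
          (\<integral>\<^sup>+\<omega>. indicator (ball 0 (2 * (r / 2))) (X u \<omega>) * f (s + u, X u \<omega> + x) \<partial>M) \<partial>lborel) \<le>
        (SUP (s, x) \<in> UNIV. ?local s x)" .
    qed simp
    finally show "?global t s x \<le> 2 * (SUP (s, x) \<in> UNIV. ?local s x)" .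
  qed
  then show ?thesis
    using S(1) r by (intro eventually_at_rightI[of 0 "min \<delta> r"]) auto
qed

end

section \<open>Return to the original process and the equivalence\<close>

lemma expectation_from_cong_AE:
  fixes g :: "real \<Rightarrow> 'a::real_vector \<Rightarrow> ennreal"
  assumes "AE \<omega> in M. \<forall>t\<ge>0. Y t \<omega> = X t \<omega>"
  shows "expectation_from M X x (\<lambda>Z. \<integral>\<^sup>+u\<in>{0..t}. g u (Z u) \<partial>lborel) =
    expectation_from M Y x (\<lambda>Z. \<integral>\<^sup>+u\<in>{0..t}. g u (Z u) \<partial>lborel)"
  unfolding expectation_from_def
proof (rule nn_integral_cong_AE)
  show "AE \<omega> in M. (\<integral>\<^sup>+u\<in>{0..t}. g u (X u \<omega> + x) \<partial>lborel) = (\<integral>\<^sup>+u\<in>{0..t}. g u (Y u \<omega> + x) \<partial>lborel)"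
    using assms by eventually_elim (auto intro!: nn_integral_cong split: split_indicator)
qed

theorem corollary1p2:
  fixes M :: "'w measure"
    and X :: "real \<Rightarrow> 'w \<Rightarrow> real ^ 'd"
    and q :: "real \<times> (real ^ 'd) \<Rightarrow> real"
  assumes "levy_process M X"
    and "q \<in> borel_measurable borel"
  shows
    "((\<lambda>t. SUP (s, x) \<in> UNIV.
         expectation_from M X x (\<lambda>Y. \<integral>\<^sup>+u\<in>{0..t}. ennreal \<bar>q (s + u, Y u)\<bar> \<partial>lborel))
       \<longlongrightarrow> 0) (at_right 0)
     \<longleftrightarrow>
     ((\<lambda>r. SUP (s, x) \<in> UNIV.
         expectation_from M X x
           (\<lambda>Y. \<integral>\<^sup>+u\<in>{0..r}. indicator (ball x r) (Y u) * ennreal \<bar>q (s + u, Y u)\<bar> \<partial>lborel))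
       \<longlongrightarrow> 0) (at_right 0)"
    (is "(?global \<longlongrightarrow> 0) _ \<longleftrightarrow> (?local \<longlongrightarrow> 0) _")
proof
  assume "(?global \<longlongrightarrow> 0) (at_right 0)"
  then show "(?local \<longlongrightarrow> 0) (at_right 0)"
  proof (rule tendsto_sandwich[OF _ _ tendsto_const, rotated 2])
    show "\<forall>\<^sub>F r in at_right 0. ?local r \<le> ?global r"
      unfolding expectation_from_def
      by (intro always_eventually allI SUP_mono' nn_integral_mono)
         (auto intro!: nn_integral_mono split: split_indicator)
  qed simp
next
  assume local: "(?local \<longlongrightarrow> 0) (at_right 0)"
  interpret levy_process M X by fact
  obtain Y where Y: "measurable_levy_process M Y" and eq: "AE \<omega> in M. \<forall>t\<ge>0. Y t \<omega> = X t \<omega>"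
    by (rule measurable_version)
  note cong = expectation_from_cong_AE[OF eq]
  \<comment> \<open>The estimate is proved for the version \<open>Y\<close> and carried back to
    \<open>X\<close>, since both expectations agree.\<close>
  have bound: "\<forall>\<^sub>F t in at_right 0. ?global t \<le> 2 * ?local r" if "0 < r" for r
    using measurable_levy_process.SUP_expectation_le_local[OF Y _ that, of "\<lambda>p. ennreal \<bar>q p\<bar>"] assms(2)
    by (simp add: cong[of _ "\<lambda>u y. ennreal \<bar>q (s + u, y)\<bar>" for s]
      cong[of x "\<lambda>u y. indicator (ball x r) y * ennreal \<bar>q (s + u, y)\<bar>" for s x])
  show "(?global \<longlongrightarrow> 0) (at_right 0)"
  proof (rule order_tendstoI)
    fix a :: ennreal assume "0 < a"
    have "((\<lambda>r. 2 * ?local r) \<longlongrightarrow> 2 * 0) (at_right 0)"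
      by (intro ennreal_tendsto_cmult local) simp
    then have "\<forall>\<^sub>F r in at_right 0. 2 * ?local r < a"
      using \<open>0 < a\<close> by (intro order_tendstoD(2)) simp_all
    then obtain b where "0 < b" and b: "\<And>r. 0 < r \<Longrightarrow> r < b \<Longrightarrow> 2 * ?local r < a"
      by (auto simp: eventually_at_right_field)
    \<comment> \<open>The radius \<open>b / 2\<close> is fixed first; the bound for this radius then
      holds for all sufficiently small \<open>t\<close>.\<close>
    then have "0 < b / 2" "2 * ?local (b / 2) < a"
      by auto
    then show "\<forall>\<^sub>F t in at_right 0. ?global t < a"
      using bound[of "b / 2"] by (auto elim!: eventually_mono intro: le_less_trans)
  qed simp
qed

end
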